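(* Let $f:\{\pm1\}^n\to\mathbb{R}$ be a linear function, i.e. $f(x_1,\dots,x_n)=\hat f(\emptyset)+\sum_{i=1}^n\hat f(\{i\})x_i$. Consider the canonical holdout where the $k$-th component is frozen at training, for a linear regression model where weights and biases are initialized independently with the same mean and variance $\sigma^2$. Let $\tilde f^{(t)}_{-k}$ be the function learned by gradient descent (GD) after $t$ time steps. (i) Assume the frozen function is unbiased, i.e. $\mathbb{E}_{X_{-k}}[f(X_{-k})]=0$. Then the expected generalization error (over different initializations $\Theta^0$) is $$\mathbb{E}_{\Theta^0}\big[\mathrm{gen}(f,\tilde f^{(t)}_{-k})\big]=\mathrm{Inf}_k(f)+o_{\sigma^2}(1)+O(e^{-ct}),$$ where $c$ is a constant dependent on the learning rate. (ii) Moreover, if the frozen function is biased, the expected generalization error is $$\mathbb{E}_{\Theta^0}\big[\mathrm{gen}(f,\tilde f^{(t)}_{-k})\big]=\frac{(\hat f(\emptyset)-\hat f(\{k\}))^2}{4}+o_{\sigma^2}(1)+O(e^{-ct}).$$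
   Context: Canonical holdout ($k\in\{1,\dots,n\}$): at training, inputs $X_{-k}$ have $k$-th component frozen to $1$ and the other components i.i.d. uniform on $\{\pm1\}$; at testing, $X$ is uniform on $\{\pm1\}^n$. The frozen function is $x\mapsto f(x_{-k})$, where $x_{-k}$ is $x$ with its $k$-th component replaced by $1$. Linear regression model: $x\mapsto x^TW+b$ with parameters $\Theta=(W,b)$, $W\in\mathbb{R}^n$, $b\in\mathbb{R}$, trained by gradient descent on the square loss averaged over the training distribution, $\mathbb{E}_{X_{-k}}\big(X_{-k}^TW+b-f(X_{-k})\big)^2$, from the random initialization $\Theta^0=(W^{(0)},b^{(0)})$; $\tilde f^{(t)}_{-k}(x)=x^TW^{(t)}+b^{(t)}$. Generalization error: $\mathrm{gen}(f,\tilde f)=\frac12\mathbb{E}_X(f(X)-\tilde f(X))^2$ with $X$ uniform on $\{\pm1\}^n$. Boolean influence: writing $f=\sum_{T\subseteq[n]}\hat f(T)\chi_T$ with $\chi_T(x)=\prod_{i\in T}x_i$, $\mathrm{Inf}_k(f)=\sum_{T\subseteq[n]:\,k\in T}\hat f(T)^2$. Notation: $o_{\sigma^2}(1)$ denotes a term tending to $0$ as $\sigma^2\to0$; $O(e^{-ct})$ is as $t\to\infty$.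
   Formalization: The learning rate γ is assumed to satisfy 0 < γ < 1/2 (constant step size, square loss without factor 1/2); outside this range gradient descent does not converge and the claimed expansion with c > 0 fails. *)

theory Defs
  imports "HOL-Probability.Probability"
begin

section \<open>Boolean functions\<close>

text \<open>
  A function on \<open>{\<plusminus>1}\<^sup>n\<close> is represented by a total function on \<^typ>\<open>real ^ 'n\<close>, with
  \<open>n = CARD('n)\<close>; only its values on \<open>cube\<close> are ever used.
\<close>

definition cube :: "(real ^ 'n) set" where
  "cube = {x. \<forall>i. x $ i \<in> {-1, 1}}"

definition character :: "'n::finite set \<Rightarrow> real ^ 'n \<Rightarrow> real" where
  "character T x = (\<Prod>i\<in>T. x $ i)"

definition fourier_coeff :: "(real ^ 'n::finite \<Rightarrow> real) \<Rightarrow> 'n set \<Rightarrow> real" where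
  "fourier_coeff f T = measure_pmf.expectation (pmf_of_set cube) (\<lambda>x. f x * character T x)"

definition influence :: "'n::finite \<Rightarrow> (real ^ 'n \<Rightarrow> real) \<Rightarrow> real" where
  "influence k f = (\<Sum>T | k \<in> T. (fourier_coeff f T)\<^sup>2)"

definition linear_on_cube :: "(real ^ 'n::finite \<Rightarrow> real) \<Rightarrow> bool" where
  "linear_on_cube f \<longleftrightarrow>
     (\<forall>x\<in>cube. f x = fourier_coeff f {} + (\<Sum>i\<in>UNIV. fourier_coeff f {i} * x $ i))"


section \<open>Canonical holdout and linear regression\<close>

definition freeze :: "'n \<Rightarrow> real ^ 'n::finite \<Rightarrow> real ^ 'n" where
  "freeze k x = (\<chi> i. if i = k then 1 else x $ i)"

definition train_dist :: "'n \<Rightarrow> (real ^ 'n::finite) pmf" where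
  "train_dist k = map_pmf (freeze k) (pmf_of_set cube)"

type_synonym 'n params = "(real ^ 'n) \<times> real"

definition lin_model :: "'n::finite params \<Rightarrow> real ^ 'n \<Rightarrow> real" where
  "lin_model \<Theta> x = x \<bullet> fst \<Theta> + snd \<Theta>"

definition train_loss :: "(real ^ 'n::finite \<Rightarrow> real) \<Rightarrow> 'n \<Rightarrow> 'n params \<Rightarrow> real" where
  "train_loss f k \<Theta> = measure_pmf.expectation (train_dist k) (\<lambda>x. (lin_model \<Theta> x - f x)\<^sup>2)"

definition gradient :: "('a::real_inner \<Rightarrow> real) \<Rightarrow> 'a \<Rightarrow> 'a" where
  "gradient L \<Theta> = (THE g. GDERIV L \<Theta> :> g)"

primrec gd :: "real \<Rightarrow> ('a::real_inner \<Rightarrow> real) \<Rightarrow> 'a \<Rightarrow> nat \<Rightarrow> 'a" where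
  "gd \<gamma> L \<Theta>0 0 = \<Theta>0"
| "gd \<gamma> L \<Theta>0 (Suc t) = gd \<gamma> L \<Theta>0 t - \<gamma> *\<^sub>R gradient L (gd \<gamma> L \<Theta>0 t)"

definition learned :: "real \<Rightarrow> (real ^ 'n::finite \<Rightarrow> real) \<Rightarrow> 'n \<Rightarrow> 'n params \<Rightarrow> nat \<Rightarrow> real ^ 'n \<Rightarrow> real"
  where "learned \<gamma> f k \<Theta>0 t = lin_model (gd \<gamma> (train_loss f k) \<Theta>0 t)"

definition gen_error :: "(real ^ 'n::finite \<Rightarrow> real) \<Rightarrow> (real ^ 'n \<Rightarrow> real) \<Rightarrow> real" where
  "gen_error f g = 1 / 2 * measure_pmf.expectation (pmf_of_set cube) (\<lambda>x. (f x - g x)\<^sup>2)"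


section \<open>Random initialization and the error expansion\<close>

text \<open>The \<open>n + 1\<close> scalar parameters are indexed by \<^typ>\<open>'n option\<close>, with \<^term>\<open>None\<close> for the bias.\<close>

definition param :: "'n::finite option \<Rightarrow> 'n params \<Rightarrow> real" where
  "param j \<Theta> = (case j of None \<Rightarrow> snd \<Theta> | Some i \<Rightarrow> fst \<Theta> $ i)"

text \<open>
  \<open>init_law \<mu> v D\<close>: \<open>D\<close> is the law of an initialization with mutually independent
  square-integrable coordinates, each of mean \<open>\<mu>\<close> and variance \<open>v\<close>
  (not necessarily identically distributed).
\<close>

definition init_law :: "real \<Rightarrow> real \<Rightarrow> 'n::finite params measure \<Rightarrow> bool" where
  "init_law \<mu> v D \<longleftrightarrow>
     prob_space D \<and> sets D = sets borel \<and>
     prob_space.indep_vars D (\<lambda>_. borel) param UNIV \<and>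
     (\<forall>j. integrable D (\<lambda>\<Theta>. (param j \<Theta>)\<^sup>2) \<and>
          prob_space.expectation D (param j) = \<mu> \<and>
          prob_space.variance D (param j) = v)"

definition expected_gen ::
  "real \<Rightarrow> (real ^ 'n::finite \<Rightarrow> real) \<Rightarrow> 'n \<Rightarrow> 'n params measure \<Rightarrow> nat \<Rightarrow> real" where
  "expected_gen \<gamma> f k D t = (LINT \<Theta>0|D. gen_error f (learned \<gamma> f k \<Theta>0 t))"

text \<open>
  \<open>gen_expansion \<gamma> c f k m\<close>: the expected generalization error is \<open>m + o(1) + O(e\<^sup>-\<^sup>c\<^sup>t)\<close>.
  The term \<open>r v\<close>, with \<open>v\<close> the variance, is the \<open>o(1)\<close> as \<open>v\<close> tends to \<open>0\<close>; it does not
  depend on \<open>t\<close>. The constant of the \<open>O\<close>-term does not depend on \<open>t\<close> and is uniform over all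
  initialization laws of bounded mean and variance, in particular as \<open>v\<close> tends to \<open>0\<close>.
\<close>

definition gen_expansion ::
  "real \<Rightarrow> real \<Rightarrow> (real ^ 'n::finite \<Rightarrow> real) \<Rightarrow> 'n \<Rightarrow> real \<Rightarrow> bool" where
  "gen_expansion \<gamma> c f k m \<longleftrightarrow>
     (\<exists>r. (r \<longlongrightarrow> 0) (at_right 0) \<and>
       (\<forall>B. \<exists>C. \<forall>\<mu> v D t. init_law \<mu> v D \<longrightarrow> \<bar>\<mu>\<bar> \<le> B \<longrightarrow> v \<le> B \<longrightarrow>
          \<bar>expected_gen \<gamma> f k D t - (m + r v)\<bar> \<le> C * exp (- c * real t)))"


section \<open>Well-definedness\<close>

lemma gradient_eqI:
  assumes "GDERIV L \<Theta> :> g"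
  shows "gradient L \<Theta> = g"
  unfolding gradient_def
proof (rule the_equality)
  show "GDERIV L \<Theta> :> g" by (fact assms)
  fix g' assume "GDERIV L \<Theta> :> g'"
  with assms have "(\<lambda>h. inner h g') = (\<lambda>h. inner h g)"
    unfolding gderiv_def by (rule has_derivative_unique[rotated])
  then have "inner (g' - g) (g' - g) = 0"
    by (metis inner_diff_right right_minus_eq)
  then show "g' = g" by simp
qed

lemma cube_eq: "(cube :: (real ^ 'n::finite) set) = (\<lambda>g. \<chi> i. g i) ` (UNIV \<rightarrow>\<^sub>E {-1, 1})"
proof (intro set_eqI iffI)
  fix x :: "real ^ 'n" assume "x \<in> cube"
  then have "(\<lambda>i. x $ i) \<in> UNIV \<rightarrow>\<^sub>E {-1, 1}" "x = (\<chi> i. x $ i)"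
    by (auto simp: cube_def)
  then show "x \<in> (\<lambda>g. \<chi> i. g i) ` (UNIV \<rightarrow>\<^sub>E {-1, 1})" by blast
qed (auto simp: cube_def PiE_def Pi_def)

lemma finite_cube [simp]: "finite (cube :: (real ^ 'n::finite) set)"
  unfolding cube_eq by (intro finite_imageI finite_PiE) auto

lemma cube_nonempty [simp]: "(cube :: (real ^ 'n::finite) set) \<noteq> {}"
proof -
  have "(\<chi> i. 1) \<in> (cube :: (real ^ 'n) set)" by (simp add: cube_def)
  then show ?thesis by blast
qed

lemma card_cube: "card (cube :: (real ^ 'n::finite) set) = 2 ^ CARD('n)"
proof -
  have "inj_on (\<lambda>g. \<chi> i. g i :: real ^ 'n) (UNIV \<rightarrow>\<^sub>E {-1, 1})"
    by (auto simp: inj_on_def vec_eq_iff)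
  then have "card (cube :: (real ^ 'n) set) = card ((UNIV :: 'n set) \<rightarrow>\<^sub>E {-1, 1 :: real})"
    unfolding cube_eq by (rule card_image)
  also have "\<dots> = 2 ^ CARD('n)"
    by (subst card_PiE) (auto simp: numeral_eq_Suc)
  finally show ?thesis .
qed

lemma expectation_cube:
  "measure_pmf.expectation (pmf_of_set (cube :: (real ^ 'n::finite) set)) g
     = (\<Sum>x\<in>cube. g x) / 2 ^ CARD('n)" for g :: "real ^ 'n \<Rightarrow> real"
  by (simp add: integral_pmf_of_set card_cube)

text \<open>
  \<open>fourier_coeff f\<close> is the unique family of coefficients with
  \<open>f = (\<Sum>T. fourier_coeff f T * character T)\<close> on the cube.
\<close>

lemma sum_characters:
  fixes x y :: "real ^ 'n::finite"
  assumes "x \<in> cube" "y \<in> cube"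
  shows "(\<Sum>T\<in>UNIV. character T x * character T y) = (if x = y then 2 ^ CARD('n) else 0)"
proof -
  have *: "(\<Sum>T\<in>UNIV. character T x * character T y) = (\<Prod>i\<in>UNIV. x $ i * y $ i + 1)"
    by (simp add: prod_add character_def prod.distrib)
  show ?thesis
  proof (cases "x = y")
    case True
    have "y $ i * y $ i + 1 = 2" for i
    proof -
      have "y $ i = -1 \<or> y $ i = 1" using assms(2) by (auto simp: cube_def)
      then show ?thesis by auto
    qed
    then show ?thesis using True * by simp
  next
    case False
    then obtain i where "x $ i \<noteq> y $ i" by (auto simp: vec_eq_iff)
    moreover have "x $ i \<in> {-1, 1}" "y $ i \<in> {-1, 1}" using assms by (auto simp: cube_def)
    ultimately have "x $ i * y $ i + 1 = 0" by auto
    then have "(\<Prod>i\<in>UNIV. x $ i * y $ i + 1) = 0" by (intro prod_zero) auto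
    then show ?thesis using False * by simp
  qed
qed

lemma fourier_expansion:
  fixes f :: "real ^ 'n::finite \<Rightarrow> real"
  assumes "x \<in> cube"
  shows "f x = (\<Sum>T\<in>UNIV. fourier_coeff f T * character T x)"
proof -
  have "(\<Sum>T\<in>UNIV. fourier_coeff f T * character T x)
      = (\<Sum>T\<in>UNIV. \<Sum>y\<in>cube. f y * (character T x * character T y)) / 2 ^ CARD('n)"
    by (simp add: fourier_coeff_def expectation_cube sum_divide_distrib sum_distrib_left mult_ac)
  also have "\<dots> = (\<Sum>y\<in>cube. f y * (\<Sum>T\<in>UNIV. character T x * character T y)) / 2 ^ CARD('n)"
    by (subst sum.swap) (simp add: sum_distrib_left)
  also have "\<dots> = (\<Sum>y\<in>cube. f y * (if x = y then 2 ^ CARD('n) else 0)) / 2 ^ CARD('n)"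
    using assms by (simp add: sum_characters)
  also have "\<dots> = f x"
    using assms by (simp add: if_distrib[of "(*) _"] sum.delta cong: if_cong)
  finally show ?thesis ..
qed

lemma character_orthogonal:
  fixes S T :: "'n::finite set"
  shows "measure_pmf.expectation (pmf_of_set cube) (\<lambda>x. character S x * character T x)
           = (if S = T then 1 else 0)"
proof (cases "S = T")
  case True
  have "character T x * character T x = 1" if "x \<in> cube" for x :: "real ^ 'n"
  proof -
    have "x $ i * x $ i = 1" for i
    proof -
      have "x $ i = -1 \<or> x $ i = 1" using that by (auto simp: cube_def)
      then show ?thesis by auto
    qed
    then show ?thesis by (simp add: character_def flip: prod.distrib)
  qed
  then show ?thesis using True by (simp add: expectation_cube card_cube)
next
  case False
  then obtain i where i: "i \<in> S \<longleftrightarrow> i \<notin> T" by blast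
  define flip where "flip x = (\<chi> j. if j = i then - x $ j else x $ j)" for x :: "real ^ 'n"
  have ff: "flip (flip x) = x" for x by (simp add: flip_def vec_eq_iff)
  have fc: "flip x \<in> cube" if "x \<in> cube" for x using that by (auto simp: flip_def cube_def)
  have ch: "character U (flip x) = (if i \<in> U then - 1 else 1) * character U x" for U x
  proof -
    have "character U (flip x) = (\<Prod>j\<in>U. (if j = i then - 1 else 1) * x $ j)"
      by (auto simp: character_def flip_def intro!: prod.cong)
    then show ?thesis by (simp add: character_def prod.distrib)
  qed
  let ?s = "\<Sum>x\<in>cube. character S x * character T x"
  have "?s = (\<Sum>x\<in>cube. character S (flip x) * character T (flip x))"
    by (rule sum.reindex_bij_witness[of _ flip flip]) (auto simp: ff fc)
  also have "\<dots> = - ?s" using i by (auto simp: ch sum_negf)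
  finally show ?thesis using False by (simp add: expectation_cube)
qed

lemma fourier_coeff_unique:
  fixes f :: "real ^ 'n::finite \<Rightarrow> real"
  assumes "\<And>x. x \<in> cube \<Longrightarrow> f x = (\<Sum>T\<in>UNIV. a T * character T x)"
  shows "fourier_coeff f S = a S"
proof -
  have "fourier_coeff f S
      = (\<Sum>x\<in>cube. \<Sum>T\<in>UNIV. a T * (character T x * character S x)) / 2 ^ CARD('n)"
    using assms by (simp add: fourier_coeff_def expectation_cube sum_distrib_right mult.assoc)
  also have "\<dots> = (\<Sum>T\<in>UNIV. a T * ((\<Sum>x\<in>cube. character T x * character S x) / 2 ^ CARD('n)))"
    by (subst sum.swap) (simp add: sum_distrib_left sum_divide_distrib)
  also have "\<dots> = (\<Sum>T\<in>UNIV. a T * (if T = S then 1 else 0))"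
    using character_orthogonal[of _ S] by (simp add: expectation_cube)
  also have "\<dots> = a S" by (simp add: if_distrib[of "(*) _"] cong: if_cong)
  finally show ?thesis .
qed

end

theory Submission
  imports Defs
begin

text \<open>
  The training loss decouples into \<open>(W\<^sub>i - f\<^sub>i)\<^sup>2\<close> for \<open>i \<noteq> k\<close> and the square of the bias residual
  \<open>W\<^sub>k + b - f\<^sub>\<emptyset> - f\<^sub>k\<close>. Gradient descent contracts each of the former by \<open>1 - 2\<gamma>\<close> per step and the
  latter residual by \<open>1 - 4\<gamma>\<close>, while \<open>W\<^sub>k - b\<close> never changes. Hence the generalization error is
  \<open>(f\<^sub>\<emptyset> - f\<^sub>k + W\<^sub>k\<^sup>0 - b\<^sup>0)\<^sup>2 / 4\<close> plus terms that decay geometrically; the expectation of the former is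
  \<open>(f\<^sub>\<emptyset> - f\<^sub>k)\<^sup>2 / 4 + v / 2\<close>. An unbiased frozen function has \<open>f\<^sub>\<emptyset> = - f\<^sub>k\<close>, so there the main term
  is \<open>f\<^sub>k\<^sup>2\<close>.
\<close>

section \<open>Moments of affine functions on the cube\<close>

lemma cube_expectation_affine:
  "measure_pmf.expectation (pmf_of_set (cube :: (real ^ 'n::finite) set))
     (\<lambda>x. \<alpha> + (\<Sum>i\<in>UNIV. \<beta> i * x $ i)) = \<alpha>"
proof -
  \<comment> \<open>Each coordinate is the character of a singleton, hence orthogonal to the
    constant character of \<open>{}\<close>.\<close>
  have coord: "(\<Sum>x\<in>(cube :: (real ^ 'n) set). x $ i) = 0" for i
    using character_orthogonal[of "{i}" "{}"] by (simp add: expectation_cube character_def)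
  have "(\<Sum>x\<in>(cube :: (real ^ 'n) set). \<Sum>i\<in>UNIV. \<beta> i * x $ i) = 0"
    by (subst sum.swap) (simp add: coord flip: sum_distrib_left)
  then show ?thesis
    by (simp add: expectation_cube sum.distrib card_cube)
qed

text \<open>Parseval for affine functions: the constant 1 and the coordinates are orthonormal
  characters. Both the training loss and the generalization error are mean squares of affine
  functions, so this turns them into sums of squares of parameter errors.\<close>

lemma cube_expectation_affine_sq:
  "measure_pmf.expectation (pmf_of_set (cube :: (real ^ 'n::finite) set))
     (\<lambda>x. (\<alpha> + (\<Sum>i\<in>UNIV. \<beta> i * x $ i))\<^sup>2) = \<alpha>\<^sup>2 + (\<Sum>i\<in>UNIV. (\<beta> i)\<^sup>2)"
proof -
  let ?C = "cube :: (real ^ 'n) set"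
  \<comment> \<open>The cross terms of the square are linear in \<open>x\<close>, so together with
    the constant they fall under the previous lemma.\<close>
  have lin: "(\<Sum>x\<in>?C. \<alpha>\<^sup>2 + (\<Sum>i\<in>UNIV. (2 * \<alpha> * \<beta> i) * x $ i)) = 2 ^ CARD('n) * \<alpha>\<^sup>2"
    using cube_expectation_affine[where 'n='n, of "\<alpha>\<^sup>2" "\<lambda>i. 2 * \<alpha> * \<beta> i"]
    by (simp add: expectation_cube field_simps)
  have prods: "(\<Sum>x\<in>?C. x $ i * x $ j) = (if i = j then 2 ^ CARD('n) else 0)" for i j
    using character_orthogonal[of "{i}" "{j}"]
    by (auto simp: expectation_cube character_def split: if_splits)
  have "(\<Sum>x\<in>?C. (\<Sum>i\<in>UNIV. \<beta> i * x $ i)\<^sup>2)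
      = (\<Sum>x\<in>?C. \<Sum>i\<in>UNIV. \<Sum>j\<in>UNIV. \<beta> i * \<beta> j * (x $ i * x $ j))"
    by (simp add: power2_eq_square sum_product mult_ac)
  also have "\<dots> = (\<Sum>i\<in>UNIV. \<Sum>j\<in>UNIV. \<beta> i * \<beta> j * (\<Sum>x\<in>?C. x $ i * x $ j))"
    by (simp add: sum.swap[of _ _ ?C] sum_distrib_left)
  also have "\<dots> = 2 ^ CARD('n) * (\<Sum>i\<in>UNIV. (\<beta> i)\<^sup>2)"
    by (simp add: prods if_distrib[of "(*) _"] power2_eq_square sum_distrib_left mult_ac cong: if_cong)
  finally have quad: "(\<Sum>x\<in>?C. (\<Sum>i\<in>UNIV. \<beta> i * x $ i)\<^sup>2) = 2 ^ CARD('n) * (\<Sum>i\<in>UNIV. (\<beta> i)\<^sup>2)" .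
  have "(\<Sum>x\<in>?C. (\<alpha> + (\<Sum>i\<in>UNIV. \<beta> i * x $ i))\<^sup>2)
      = (\<Sum>x\<in>?C. (\<alpha>\<^sup>2 + (\<Sum>i\<in>UNIV. (2 * \<alpha> * \<beta> i) * x $ i)) + (\<Sum>i\<in>UNIV. \<beta> i * x $ i)\<^sup>2)"
    by (simp add: power2_sum sum_distrib_left mult_ac add_ac)
  also have "\<dots> = 2 ^ CARD('n) * (\<alpha>\<^sup>2 + (\<Sum>i\<in>UNIV. (\<beta> i)\<^sup>2))"
    by (subst sum.distrib) (simp only: lin quad distrib_left)
  finally show ?thesis by (simp add: expectation_cube)
qed

section \<open>Freezing a coordinate; Fourier coefficients of linear functions\<close>

lemma freeze_in_cube: "x \<in> cube \<Longrightarrow> freeze k x \<in> cube"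
  by (simp add: cube_def freeze_def)

lemma expectation_train_dist:
  "measure_pmf.expectation (train_dist k) g
     = measure_pmf.expectation (pmf_of_set cube) (\<lambda>x. g (freeze k x))" for g :: "_ \<Rightarrow> real"
  by (simp add: train_dist_def)

lemma expectation_cube_cong:
  fixes g h :: "real ^ 'n::finite \<Rightarrow> real"
  assumes "\<And>x. x \<in> cube \<Longrightarrow> g x = h x"
  shows "measure_pmf.expectation (pmf_of_set cube) g = measure_pmf.expectation (pmf_of_set cube) h"
  by (simp add: expectation_cube assms)

lemma sum_freeze:
  "(\<Sum>i\<in>UNIV. w i * freeze k x $ i) = w k + (\<Sum>i\<in>UNIV. (if i = k then 0 else w i) * x $ i)"
  by (simp add: sum.remove[of _ k] freeze_def)

lemma linear_on_cubeD:
  assumes "linear_on_cube f" "x \<in> cube"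
  shows "f x = fourier_coeff f {} + (\<Sum>i\<in>UNIV. fourier_coeff f {i} * x $ i)"
  using assms unfolding linear_on_cube_def by blast

lemma expectation_frozen_linear:
  assumes "linear_on_cube f"
  shows "measure_pmf.expectation (train_dist k) f = fourier_coeff f {} + fourier_coeff f {k}"
proof -
  have "measure_pmf.expectation (train_dist k) f
      = measure_pmf.expectation (pmf_of_set cube)
          (\<lambda>x. (fourier_coeff f {} + fourier_coeff f {k})
             + (\<Sum>i\<in>UNIV. (if i = k then 0 else fourier_coeff f {i}) * x $ i))"
    unfolding expectation_train_dist
    by (intro expectation_cube_cong)
       (simp only: linear_on_cubeD[OF assms freeze_in_cube] sum_freeze add.assoc)
  then show ?thesis by (simp only: cube_expectation_affine)
qed

text \<open>A linear function has no Fourier coefficients above degree one, and \<open>{k}\<close>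
  is the only set of size at most one that contains \<open>k\<close>.\<close>

lemma influence_linear:
  fixes f :: "real ^ 'n::finite \<Rightarrow> real"
  assumes "linear_on_cube f"
  shows "influence k f = (fourier_coeff f {k})\<^sup>2"
proof -
  \<comment> \<open>\<open>A\<close> consists of the sets of size at most one and \<open>a\<close>
    is the Fourier family truncated to it. Linearity says that \<open>a\<close> already represents
    \<open>f\<close>, so uniqueness identifies \<open>a\<close> with the full family.\<close>
  define A where "A = insert {} (range (\<lambda>i::'n. {i}))"
  define a where "a T = (if T \<in> A then fourier_coeff f T else 0)" for T
  have "fourier_coeff f T = a T" for T
  proof (rule fourier_coeff_unique)
    fix x :: "real ^ 'n" assume "x \<in> cube"
    have "(\<Sum>T\<in>UNIV. a T * character T x) = (\<Sum>T\<in>A. fourier_coeff f T * character T x)"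
      by (intro sum.mono_neutral_cong_right) (auto simp: a_def)
    also have "\<dots> = fourier_coeff f {} + (\<Sum>i\<in>UNIV. fourier_coeff f {i} * x $ i)"
      unfolding A_def by (subst sum.insert) (auto simp: sum.reindex character_def)
    finally show "f x = (\<Sum>T\<in>UNIV. a T * character T x)"
      using linear_on_cubeD[OF assms \<open>x \<in> cube\<close>] by simp
  qed
  moreover have "a T = 0" if "k \<in> T" "T \<noteq> {k}" for T
    using that by (auto simp: a_def A_def)
  ultimately have "fourier_coeff f T = 0" if "k \<in> T" "T \<noteq> {k}" for T
    using that by metis
  then have "(\<Sum>T | k \<in> T. (fourier_coeff f T)\<^sup>2) = (\<Sum>T\<in>{{k}}. (fourier_coeff f T)\<^sup>2)"
    by (intro sum.mono_neutral_right) auto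
  then show ?thesis by (simp add: influence_def)
qed

section \<open>Training loss and generalization error as sums of squares\<close>

lemma lin_model_alt: "lin_model \<Theta> x = snd \<Theta> + (\<Sum>i\<in>UNIV. fst \<Theta> $ i * x $ i)"
  by (simp add: lin_model_def inner_vec_def mult.commute)

text \<open>On frozen inputs the residual is affine with no weight at \<open>k\<close>, and Parseval
  applies. Trading \<open>W_k\<close> against the bias leaves the loss unchanged; this flat
  direction is the source of the error that remains.\<close>

lemma train_loss_linear:
  assumes "linear_on_cube f"
  shows "train_loss f k \<Theta>
     = (fst \<Theta> $ k + snd \<Theta> - (fourier_coeff f {} + fourier_coeff f {k}))\<^sup>2
       + (\<Sum>i\<in>UNIV-{k}. (fst \<Theta> $ i - fourier_coeff f {i})\<^sup>2)"
proof -
  let ?s = "fst \<Theta> $ k + snd \<Theta> - (fourier_coeff f {} + fourier_coeff f {k})"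
  let ?u = "\<lambda>i. if i = k then 0 else fst \<Theta> $ i - fourier_coeff f {i}"
  have "lin_model \<Theta> (freeze k x) - f (freeze k x) = ?s + (\<Sum>i\<in>UNIV. ?u i * x $ i)"
    if "x \<in> cube" for x
    unfolding lin_model_alt linear_on_cubeD[OF assms freeze_in_cube[OF that]] sum_freeze
    by (simp add: sum.remove[of _ k] sum_subtractf left_diff_distrib)
  then have "train_loss f k \<Theta>
      = measure_pmf.expectation (pmf_of_set cube) (\<lambda>x. (?s + (\<Sum>i\<in>UNIV. ?u i * x $ i))\<^sup>2)"
    unfolding train_loss_def expectation_train_dist by (intro expectation_cube_cong) simp
  also have "\<dots> = ?s\<^sup>2 + (\<Sum>i\<in>UNIV. (?u i)\<^sup>2)" by (rule cube_expectation_affine_sq)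
  also have "(\<Sum>i\<in>UNIV. (?u i)\<^sup>2) = (\<Sum>i\<in>UNIV-{k}. (fst \<Theta> $ i - fourier_coeff f {i})\<^sup>2)"
    by (simp add: sum.remove[of _ k])
  finally show ?thesis .
qed

text \<open>At testing the \<open>k\<close>-th coordinate varies again, so the errors of
  \<open>W_k\<close> and of the bias are penalized separately.\<close>

lemma gen_error_linear:
  assumes "linear_on_cube f"
  shows "gen_error f (lin_model \<Theta>)
     = ((snd \<Theta> - fourier_coeff f {})\<^sup>2 + (\<Sum>i\<in>UNIV. (fst \<Theta> $ i - fourier_coeff f {i})\<^sup>2)) / 2"
proof -
  have "f x - lin_model \<Theta> x = (fourier_coeff f {} - snd \<Theta>)
      + (\<Sum>i\<in>UNIV. (fourier_coeff f {i} - fst \<Theta> $ i) * x $ i)" if "x \<in> cube" for x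
    unfolding lin_model_alt linear_on_cubeD[OF assms that]
    by (simp add: sum_subtractf left_diff_distrib)
  then have "gen_error f (lin_model \<Theta>) = 1 / 2 * measure_pmf.expectation (pmf_of_set cube)
      (\<lambda>x. ((fourier_coeff f {} - snd \<Theta>)
         + (\<Sum>i\<in>UNIV. (fourier_coeff f {i} - fst \<Theta> $ i) * x $ i))\<^sup>2)"
    unfolding gen_error_def
    by (intro arg_cong[where f="(*) (1/2)"] expectation_cube_cong) simp
  also have "\<dots> = 1 / 2 * ((fourier_coeff f {} - snd \<Theta>)\<^sup>2
      + (\<Sum>i\<in>UNIV. (fourier_coeff f {i} - fst \<Theta> $ i)\<^sup>2))"
    by (simp only: cube_expectation_affine_sq)
  finally show ?thesis by (simp add: power2_commute)
qed

section \<open>Dynamics of gradient descent\<close>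

lemma gradient_train_loss:
  fixes f :: "real ^ 'n::finite \<Rightarrow> real" and k :: 'n
  assumes "linear_on_cube f"
  defines "s \<equiv> \<lambda>\<Theta>. fst \<Theta> $ k + snd \<Theta> - (fourier_coeff f {} + fourier_coeff f {k})"
  shows "gradient (train_loss f k) \<Theta>
     = ((\<chi> i. 2 * (if i = k then s \<Theta> else fst \<Theta> $ i - fourier_coeff f {i})), 2 * s \<Theta>)"
    (is "_ = ?g")
proof (rule gradient_eqI)
  have nth: "((\<lambda>\<Theta> :: 'n params. fst \<Theta> $ i) has_derivative (\<lambda>h. fst h $ i)) (at \<Theta>)" for i
    by (intro bounded_linear_imp_has_derivative bounded_linear_compose[OF bounded_linear_vec_nth]
        bounded_linear_fst)
  have snd: "((\<lambda>\<Theta> :: 'n params. snd \<Theta>) has_derivative snd) (at \<Theta>)"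
    by (intro bounded_linear_imp_has_derivative bounded_linear_snd)
  have "(train_loss f k has_derivative (\<lambda>h. 2 * s \<Theta> * (fst h $ k + snd h)
      + (\<Sum>i\<in>UNIV-{k}. 2 * (fst \<Theta> $ i - fourier_coeff f {i}) * fst h $ i))) (at \<Theta>)"
    unfolding train_loss_linear[OF assms(1), abs_def] s_def
    by (rule derivative_eq_intros nth snd refl)+ (simp add: fun_eq_iff algebra_simps)
  \<comment> \<open>\<open>W_k\<close> and the bias enter the loss only through \<open>s\<close>, so
    both gradient components equal \<open>2 * s \<Theta>\<close>; splitting \<open>k\<close> off the
    inner product brings them together.\<close>
  moreover have "(\<lambda>h. 2 * s \<Theta> * (fst h $ k + snd h)
      + (\<Sum>i\<in>UNIV-{k}. 2 * (fst \<Theta> $ i - fourier_coeff f {i}) * fst h $ i)) = (\<lambda>h. inner h ?g)"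
    by (simp add: fun_eq_iff inner_prod_def inner_vec_def sum.remove[of UNIV k] algebra_simps)
  ultimately show "GDERIV (train_loss f k) \<Theta> :> ?g"
    by (simp add: gderiv_def)
qed

text \<open>One step subtracts \<open>2 * \<gamma> * s\<close> from both \<open>W_k\<close> and the
  bias: their sum loses \<open>4 * \<gamma> * s\<close>, while their difference is conserved. Every
  other weight loses \<open>2 * \<gamma>\<close> times its own error.\<close>

lemma gd_train_loss:
  fixes \<gamma> :: real and f :: "real ^ 'n::finite \<Rightarrow> real" and \<Theta>0 :: "'n params" and k :: 'n
  assumes "linear_on_cube f"
  defines "\<Theta> \<equiv> gd \<gamma> (train_loss f k) \<Theta>0"
    and "s \<equiv> \<lambda>\<Theta>. fst \<Theta> $ k + snd \<Theta> - (fourier_coeff f {} + fourier_coeff f {k})"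
  shows "i \<noteq> k \<Longrightarrow> fst (\<Theta> t) $ i - fourier_coeff f {i}
           = (1 - 2 * \<gamma>) ^ t * (fst \<Theta>0 $ i - fourier_coeff f {i})"
    and "s (\<Theta> t) = (1 - 4 * \<gamma>) ^ t * s \<Theta>0"
    and "fst (\<Theta> t) $ k - snd (\<Theta> t) = fst \<Theta>0 $ k - snd \<Theta>0"
proof -
  have step: "\<Theta> (Suc t) = \<Theta> t - \<gamma> *\<^sub>R ((\<chi> i. 2 * (if i = k then s (\<Theta> t)
      else fst (\<Theta> t) $ i - fourier_coeff f {i})), 2 * s (\<Theta> t))" for t
    by (simp add: \<Theta>_def gradient_train_loss[OF assms(1)] s_def cong: if_cong)
  have other: "fst (\<Theta> (Suc t)) $ i - fourier_coeff f {i}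
      = (1 - 2 * \<gamma>) * (fst (\<Theta> t) $ i - fourier_coeff f {i})" if "i \<noteq> k" for i t
    using that by (simp add: step algebra_simps)
  have res: "s (\<Theta> (Suc t)) = (1 - 4 * \<gamma>) * s (\<Theta> t)" for t
    by (subst s_def) (simp add: step, simp add: s_def algebra_simps)
  have diff: "fst (\<Theta> (Suc t)) $ k - snd (\<Theta> (Suc t)) = fst (\<Theta> t) $ k - snd (\<Theta> t)" for t
    by (simp add: step)
  have init: "\<Theta> 0 = \<Theta>0" by (simp add: \<Theta>_def)
  show "i \<noteq> k \<Longrightarrow> fst (\<Theta> t) $ i - fourier_coeff f {i}
           = (1 - 2 * \<gamma>) ^ t * (fst \<Theta>0 $ i - fourier_coeff f {i})"
    by (induction t) (simp_all add: init other)
  show "s (\<Theta> t) = (1 - 4 * \<gamma>) ^ t * s \<Theta>0"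
    by (induction t) (simp_all add: init res)
  show "fst (\<Theta> t) $ k - snd (\<Theta> t) = fst \<Theta>0 $ k - snd \<Theta>0"
    by (induction t) (simp_all add: init diff)
qed

lemma gen_error_learned:
  fixes f :: "real ^ 'n::finite \<Rightarrow> real" and \<Theta>0 :: "'n params" and k :: 'n
  assumes "linear_on_cube f"
  shows "gen_error f (learned \<gamma> f k \<Theta>0 t)
     = (fourier_coeff f {} - fourier_coeff f {k} + fst \<Theta>0 $ k - snd \<Theta>0)\<^sup>2 / 4
       + ((1 - 4 * \<gamma>)\<^sup>2) ^ t
           * (fst \<Theta>0 $ k + snd \<Theta>0 - (fourier_coeff f {} + fourier_coeff f {k}))\<^sup>2 / 4
       + ((1 - 2 * \<gamma>)\<^sup>2) ^ t * (\<Sum>i\<in>UNIV-{k}. (fst \<Theta>0 $ i - fourier_coeff f {i})\<^sup>2) / 2"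
proof -
  let ?\<Theta> = "gd \<gamma> (train_loss f k) \<Theta>0 t"
  let ?a = "fourier_coeff f {}" and ?ak = "fourier_coeff f {k}"
  note gd = gd_train_loss[OF assms]
  have "(\<Sum>i\<in>UNIV-{k}. (fst ?\<Theta> $ i - fourier_coeff f {i})\<^sup>2)
      = (\<Sum>i\<in>UNIV-{k}. ((1 - 2 * \<gamma>)\<^sup>2) ^ t * (fst \<Theta>0 $ i - fourier_coeff f {i})\<^sup>2)"
    by (intro sum.cong) (auto simp: gd(1) power_mult_distrib mult.commute simp flip: power_mult)
  then have rest: "(\<Sum>i\<in>UNIV-{k}. (fst ?\<Theta> $ i - fourier_coeff f {i})\<^sup>2)
      = ((1 - 2 * \<gamma>)\<^sup>2) ^ t * (\<Sum>i\<in>UNIV-{k}. (fst \<Theta>0 $ i - fourier_coeff f {i})\<^sup>2)"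
    by (simp add: sum_distrib_left)
  have res: "(fst ?\<Theta> $ k + snd ?\<Theta> - (?a + ?ak))\<^sup>2
      = ((1 - 4 * \<gamma>)\<^sup>2) ^ t * (fst \<Theta>0 $ k + snd \<Theta>0 - (?a + ?ak))\<^sup>2"
    by (simp add: gd(2) power_mult_distrib mult.commute flip: power_mult)
  \<comment> \<open>With \<open>u\<close> the error of the bias and \<open>w\<close> that of
    \<open>W_k\<close>, this is \<open>u^2 + w^2 = (w - u)^2 / 2 + (w + u)^2 / 2\<close>, which
    separates the conserved difference from the contracting sum.\<close>
  have "(snd ?\<Theta> - ?a)\<^sup>2 + (fst ?\<Theta> $ k - ?ak)\<^sup>2
      = (?a - ?ak + (fst ?\<Theta> $ k - snd ?\<Theta>))\<^sup>2 / 2 + (fst ?\<Theta> $ k + snd ?\<Theta> - (?a + ?ak))\<^sup>2 / 2"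
    by (simp add: power2_eq_square field_simps)
  also have "\<dots> = (?a - ?ak + fst \<Theta>0 $ k - snd \<Theta>0)\<^sup>2 / 2
      + ((1 - 4 * \<gamma>)\<^sup>2) ^ t * (fst \<Theta>0 $ k + snd \<Theta>0 - (?a + ?ak))\<^sup>2 / 2"
    unfolding gd(3) res by (simp add: algebra_simps)
  finally show ?thesis
    unfolding learned_def gen_error_linear[OF assms]
    by (simp add: sum.remove[of UNIV k] rest)
qed

section \<open>Moments of the random initialization\<close>

lemma init_law_moments:
  fixes D :: "'n::finite params measure"
  assumes "init_law \<mu> v D"
  shows "integrable D (param j)" "integrable D (\<lambda>\<Theta>. (param j \<Theta>)\<^sup>2)"
    and "(LINT \<Theta>|D. param j \<Theta>) = \<mu>" "(LINT \<Theta>|D. (param j \<Theta>)\<^sup>2) = v + \<mu>\<^sup>2"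
    and "i \<noteq> j \<Longrightarrow> integrable D (\<lambda>\<Theta>. param i \<Theta> * param j \<Theta>)"
    and "i \<noteq> j \<Longrightarrow> (LINT \<Theta>|D. param i \<Theta> * param j \<Theta>) = \<mu>\<^sup>2"
proof -
  interpret prob_space D using assms by (simp add: init_law_def)
  have indep: "indep_vars (\<lambda>_. borel) param UNIV"
    and sq: "\<And>j. integrable D (\<lambda>\<Theta>. (param j \<Theta>)\<^sup>2)"
    and mean: "\<And>j. expectation (param j) = \<mu>"
    and var: "\<And>j. variance (param j) = v"
    using assms by (auto simp: init_law_def)
  have rv: "random_variable borel (param j)" for j
    using indep by (simp add: indep_vars_def)
  have int: "integrable D (param j)" for j
    using rv sq by (rule square_integrable_imp_integrable)
  show "integrable D (param j)" "integrable D (\<lambda>\<Theta>. (param j \<Theta>)\<^sup>2)"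
    "(LINT \<Theta>|D. param j \<Theta>) = \<mu>" by (fact int sq mean)+
  show "(LINT \<Theta>|D. (param j \<Theta>)\<^sup>2) = v + \<mu>\<^sup>2"
    using variance_eq[OF int sq] var mean by (simp add: algebra_simps)
  assume "i \<noteq> j"
  \<comment> \<open>Restricting mutual independence to a pair lets the expectation of the product
    factor into \<open>\<mu> * \<mu>\<close>.\<close>
  moreover have "indep_vars (\<lambda>_. borel) param {i, j}"
    using indep by (rule indep_vars_subset) simp
  ultimately show "integrable D (\<lambda>\<Theta>. param i \<Theta> * param j \<Theta>)"
    "(LINT \<Theta>|D. param i \<Theta> * param j \<Theta>) = \<mu>\<^sup>2"
    using indep_vars_integrable[of "{i, j}" param] indep_vars_lebesgue_integral[of "{i, j}" param]
    by (simp_all add: int mean power2_eq_square)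
qed

text \<open>Used in the final estimate to see that the decaying terms are nonnegative.\<close>

lemma init_law_variance_nonneg:
  assumes "init_law \<mu> v D"
  shows "0 \<le> v"
proof -
  have "v = prob_space.variance D (param None)"
    using assms unfolding init_law_def by metis
  also have "\<dots> \<ge> 0" by (rule integral_nonneg_AE) simp
  finally show ?thesis .
qed

text \<open>Second moment as variance plus squared mean, where variances of independent coordinates
  add. The cases \<open>\<beta> = -1\<close> and \<open>\<beta> = 1\<close> serve the conserved
  difference and the contracting sum of \<open>W_k\<close> and the bias.\<close>

lemma init_law_affine_sq:
  assumes "init_law \<mu> v D"
  shows "integrable D (\<lambda>\<Theta>. (param j \<Theta> + \<alpha>)\<^sup>2)"
    and "(LINT \<Theta>|D. (param j \<Theta> + \<alpha>)\<^sup>2) = v + (\<mu> + \<alpha>)\<^sup>2"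
    and "i \<noteq> j \<Longrightarrow> integrable D (\<lambda>\<Theta>. (param i \<Theta> + \<beta> * param j \<Theta> + \<alpha>)\<^sup>2)"
    and "i \<noteq> j \<Longrightarrow> (LINT \<Theta>|D. (param i \<Theta> + \<beta> * param j \<Theta> + \<alpha>)\<^sup>2)
           = (1 + \<beta>\<^sup>2) * v + ((1 + \<beta>) * \<mu> + \<alpha>)\<^sup>2"
proof -
  interpret prob_space D using assms by (simp add: init_law_def)
  note [simp] = init_law_moments[OF assms] and [simp] = prob_space
  have one: "(\<lambda>\<Theta>. (param j \<Theta> + \<alpha>)\<^sup>2) = (\<lambda>\<Theta>. (param j \<Theta>)\<^sup>2 + 2 * \<alpha> * param j \<Theta> + \<alpha>\<^sup>2)"
    by (simp add: power2_sum algebra_simps)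
  show "integrable D (\<lambda>\<Theta>. (param j \<Theta> + \<alpha>)\<^sup>2)" unfolding one by simp
  show "(LINT \<Theta>|D. (param j \<Theta> + \<alpha>)\<^sup>2) = v + (\<mu> + \<alpha>)\<^sup>2"
    unfolding one by (simp add: power2_sum)
  have two: "(\<lambda>\<Theta>. (param i \<Theta> + \<beta> * param j \<Theta> + \<alpha>)\<^sup>2)
      = (\<lambda>\<Theta>. (param i \<Theta>)\<^sup>2 + \<beta>\<^sup>2 * (param j \<Theta>)\<^sup>2 + 2 * \<beta> * (param i \<Theta> * param j \<Theta>)
          + 2 * \<alpha> * param i \<Theta> + 2 * \<alpha> * \<beta> * param j \<Theta> + \<alpha>\<^sup>2)"
    by (simp add: power2_eq_square algebra_simps)
  assume "i \<noteq> j"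
  note [simp] = init_law_moments(5,6)[OF assms \<open>i \<noteq> j\<close>]
  show "integrable D (\<lambda>\<Theta>. (param i \<Theta> + \<beta> * param j \<Theta> + \<alpha>)\<^sup>2)" unfolding two by simp
  show "(LINT \<Theta>|D. (param i \<Theta> + \<beta> * param j \<Theta> + \<alpha>)\<^sup>2)
      = (1 + \<beta>\<^sup>2) * v + ((1 + \<beta>) * \<mu> + \<alpha>)\<^sup>2"
    unfolding two by simp (simp add: power2_eq_square algebra_simps)
qed

text \<open>An exact formula for every \<open>t\<close>. The term \<open>v / 2\<close> comes from
  the difference of the initial \<open>W_k\<close> and bias: its variance is \<open>2 * v\<close>,
  and its mean is 0 because the two means agree.\<close>

lemma expected_gen_linear:
  fixes f :: "real ^ 'n::finite \<Rightarrow> real"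
  assumes "linear_on_cube f" and D: "init_law \<mu> v D"
  shows "expected_gen \<gamma> f k D t = (fourier_coeff f {} - fourier_coeff f {k})\<^sup>2 / 4 + v / 2
       + ((1 - 4 * \<gamma>)\<^sup>2) ^ t
           * (2 * v + (2 * \<mu> - (fourier_coeff f {} + fourier_coeff f {k}))\<^sup>2) / 4
       + ((1 - 2 * \<gamma>)\<^sup>2) ^ t * (\<Sum>i\<in>UNIV-{k}. v + (\<mu> - fourier_coeff f {i})\<^sup>2) / 2"
proof -
  let ?a = "fourier_coeff f {}" and ?ak = "fourier_coeff f {k}"
  \<comment> \<open>The closed form is written in the exact shape of
    \<open>init_law_affine_sq\<close>, with \<open>\<beta>\<close> equal to -1 and 1.\<close>
  have gen: "gen_error f (learned \<gamma> f k \<Theta> t)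
     = (param (Some k) \<Theta> + (- 1) * param None \<Theta> + (?a - ?ak))\<^sup>2 / 4
       + ((1 - 4 * \<gamma>)\<^sup>2) ^ t * (param (Some k) \<Theta> + 1 * param None \<Theta> + - (?a + ?ak))\<^sup>2 / 4
       + ((1 - 2 * \<gamma>)\<^sup>2) ^ t
           * (\<Sum>i\<in>UNIV-{k}. (param (Some i) \<Theta> + - fourier_coeff f {i})\<^sup>2) / 2" for \<Theta>
    unfolding gen_error_learned[OF assms(1)] by (simp add: param_def algebra_simps)
  have ne: "Some k \<noteq> None" by simp
  note ints = init_law_affine_sq(1)[OF D] init_law_affine_sq(3)[OF D ne]
  \<comment> \<open>Linearity is stated for abstract integrands, which keeps the squares from being
    expanded.\<close>
  have integral_comb: "(LINT \<Theta>|D. X \<Theta> / 4 + p * Y \<Theta> / 4 + q * (\<Sum>i\<in>I. Z i \<Theta>) / 2)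
      = (LINT \<Theta>|D. X \<Theta>) / 4 + p * (LINT \<Theta>|D. Y \<Theta>) / 4 + q * (\<Sum>i\<in>I. LINT \<Theta>|D. Z i \<Theta>) / 2"
    if "integrable D X" "integrable D Y" "\<And>i. integrable D (Z i)"
    for X Y :: "'n params \<Rightarrow> real" and Z :: "'n \<Rightarrow> 'n params \<Rightarrow> real" and p q I
    using that by simp
  have "expected_gen \<gamma> f k D t
     = (LINT \<Theta>|D. (param (Some k) \<Theta> + (- 1) * param None \<Theta> + (?a - ?ak))\<^sup>2) / 4
       + ((1 - 4 * \<gamma>)\<^sup>2) ^ t
           * (LINT \<Theta>|D. (param (Some k) \<Theta> + 1 * param None \<Theta> + - (?a + ?ak))\<^sup>2) / 4
       + ((1 - 2 * \<gamma>)\<^sup>2) ^ t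
           * (\<Sum>i\<in>UNIV-{k}. LINT \<Theta>|D. (param (Some i) \<Theta> + - fourier_coeff f {i})\<^sup>2) / 2"
    unfolding expected_gen_def gen
    by (intro integral_comb ints)
  then show ?thesis
    unfolding init_law_affine_sq(2)[OF D] init_law_affine_sq(4)[OF D ne]
    by (simp only: add_uminus_conv_diff) (simp add: add_divide_distrib)
qed

section \<open>Uniform error bound and conclusion\<close>

lemma square_shift_le:
  fixes x y \<alpha> :: real
  assumes "\<bar>x\<bar> \<le> y"
  shows "(x - \<alpha>)\<^sup>2 \<le> (y + \<bar>\<alpha>\<bar>)\<^sup>2"
  using assms by (intro power2_le_iff_abs_le[THEN iffD2]) linarith+

text \<open>The exact formula shows that \<open>r v = v / 2\<close> works. Any \<open>c\<close> for
  which \<open>exp (- c)\<close> dominates both squared contraction factors is a valid rate.\<close>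

lemma gen_expansion_linear:
  fixes f :: "real ^ 'n::finite \<Rightarrow> real"
  assumes "linear_on_cube f"
    and q4: "(1 - 4 * \<gamma>)\<^sup>2 \<le> exp (- c)" and q2: "(1 - 2 * \<gamma>)\<^sup>2 \<le> exp (- c)"
  shows "gen_expansion \<gamma> c f k ((fourier_coeff f {} - fourier_coeff f {k})\<^sup>2 / 4)"
  unfolding gen_expansion_def
proof (intro exI[of _ "\<lambda>v. v / 2"] conjI allI)
  show "((\<lambda>v. v / 2) \<longlongrightarrow> 0) (at_right (0::real))"
    by (auto intro!: tendsto_eq_intros)
  fix B :: real
  \<comment> \<open>\<open>P\<close> and \<open>Q\<close> bound the coefficients of the two decaying
    powers over all admissible \<open>\<mu>\<close> and \<open>v\<close>, so the final constant
    depends on the law only through \<open>B\<close>.\<close>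
  define P where "P = 2 * B + (2 * B + \<bar>fourier_coeff f {} + fourier_coeff f {k}\<bar>)\<^sup>2"
  define Q where "Q = (\<Sum>i\<in>UNIV-{k}. B + (B + \<bar>fourier_coeff f {i}\<bar>)\<^sup>2)"
  show "\<exists>C. \<forall>\<mu> v D t. init_law \<mu> v D \<longrightarrow> \<bar>\<mu>\<bar> \<le> B \<longrightarrow> v \<le> B \<longrightarrow>
      \<bar>expected_gen \<gamma> f k D t - ((fourier_coeff f {} - fourier_coeff f {k})\<^sup>2 / 4 + v / 2)\<bar>
        \<le> C * exp (- c * real t)"
  proof (intro exI[of _ "P / 4 + Q / 2"] allI impI)
    fix \<mu> v t and D :: "'n params measure"
    assume D: "init_law \<mu> v D" and \<mu>: "\<bar>\<mu>\<bar> \<le> B" and v: "v \<le> B"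
    let ?p = "2 * v + (2 * \<mu> - (fourier_coeff f {} + fourier_coeff f {k}))\<^sup>2"
    let ?q = "\<Sum>i\<in>UNIV-{k}. v + (\<mu> - fourier_coeff f {i})\<^sup>2"
    let ?E = "exp (- c * real t)"
    have v0: "0 \<le> v" using D by (rule init_law_variance_nonneg)
    have E: "exp (- c) ^ t = ?E"
      by (simp add: mult.commute flip: exp_of_nat_mult)
    have p: "0 \<le> ?p" "?p \<le> P"
      using v0 v \<mu> unfolding P_def by (auto intro!: add_mono square_shift_le)
    have q: "0 \<le> ?q" "?q \<le> Q"
      using v0 v \<mu> unfolding Q_def by (auto intro!: sum_nonneg sum_mono add_mono square_shift_le)
    have "((1 - 4 * \<gamma>)\<^sup>2) ^ t * ?p \<le> ?E * P" "((1 - 2 * \<gamma>)\<^sup>2) ^ t * ?q \<le> ?E * Q"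
      using p q power_mono[OF q4, of t] power_mono[OF q2, of t]
      by (auto simp only: E intro!: mult_mono zero_le_power2 exp_ge_zero)
    moreover have "0 \<le> ((1 - 4 * \<gamma>)\<^sup>2) ^ t * ?p" "0 \<le> ((1 - 2 * \<gamma>)\<^sup>2) ^ t * ?q"
      using p q by simp_all
    ultimately show "\<bar>expected_gen \<gamma> f k D t
        - ((fourier_coeff f {} - fourier_coeff f {k})\<^sup>2 / 4 + v / 2)\<bar> \<le> (P / 4 + Q / 2) * ?E"
      unfolding expected_gen_linear[OF assms(1) D] by (simp only: abs_le_iff distrib_right) argo
  qed
qed

theorem theorem2:
  fixes \<gamma> :: real
  assumes "0 < \<gamma>" and "\<gamma> < 1 / 2"
  shows "\<exists>c>0. \<forall>(f :: real ^ 'n::finite \<Rightarrow> real) k. linear_on_cube f \<longrightarrow>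
           (measure_pmf.expectation (train_dist k) f = 0 \<longrightarrow>
              gen_expansion \<gamma> c f k (influence k f)) \<and>
           (measure_pmf.expectation (train_dist k) f \<noteq> 0 \<longrightarrow>
              gen_expansion \<gamma> c f k ((fourier_coeff f {} - fourier_coeff f {k})\<^sup>2 / 4))"
proof -
  \<comment> \<open>The slower of the two decay factors; it depends on \<open>\<gamma>\<close>
    alone, so one rate serves all \<open>f\<close> and \<open>k\<close>. It is positive, as
    \<open>ln q\<close> requires, because \<open>1 - 2 * \<gamma> > 0\<close>. It is below 1 because
    \<open>0 < \<gamma> < 1 / 2\<close> gives \<open>\<bar>1 - 4 * \<gamma>\<bar> < 1\<close> and
    \<open>\<bar>1 - 2 * \<gamma>\<bar> < 1\<close>.\<close>
  define q where "q = max ((1 - 4 * \<gamma>)\<^sup>2) ((1 - 2 * \<gamma>)\<^sup>2)"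
  have "0 < q" using assms by (simp add: q_def less_max_iff_disj)
  moreover have "q < 1"
    using assms by (simp add: q_def abs_square_less_1)
  ultimately have c: "- ln q > 0" "exp (- (- ln q)) = q" by simp_all
  show ?thesis
  proof (intro exI[of _ "- ln q"] conjI[OF c(1)] allI impI)
    fix f :: "real ^ 'n \<Rightarrow> real" and k
    assume f: "linear_on_cube f"
    have exp: "gen_expansion \<gamma> (- ln q) f k ((fourier_coeff f {} - fourier_coeff f {k})\<^sup>2 / 4)"
      \<comment> \<open>Rewriting \<open>exp (- (- ln q))\<close> to \<open>q\<close> reduces both
        rate conditions to bounds by a maximum.\<close>
      using f by (rule gen_expansion_linear; unfold c(2)) (simp_all add: q_def)
    have "influence k f = (fourier_coeff f {} - fourier_coeff f {k})\<^sup>2 / 4"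
      if "measure_pmf.expectation (train_dist k) f = 0"
    proof -
      have "fourier_coeff f {} = - fourier_coeff f {k}"
        using that unfolding expectation_frozen_linear[OF f] by simp
      then show ?thesis by (simp add: influence_linear[OF f] power2_eq_square)
    qed
    with exp show "(measure_pmf.expectation (train_dist k) f = 0 \<longrightarrow>
          gen_expansion \<gamma> (- ln q) f k (influence k f)) \<and>
        (measure_pmf.expectation (train_dist k) f \<noteq> 0 \<longrightarrow>
          gen_expansion \<gamma> (- ln q) f k ((fourier_coeff f {} - fourier_coeff f {k})\<^sup>2 / 4))"
      by metis
  qed
qed

end
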